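(* Let $\mathcal{D}\subseteq\mathbb{R}^n$ be convex, let $\mathcal{U}\subseteq\mathbb{R}^d$ be nonempty, closed, bounded and convex, and let $f_1,\dots,f_m:\mathcal{D}\times\mathcal{U}\to\mathbb{R}$ be such that $f_i(\cdot,u)$ is convex on $\mathcal{D}$ for every $u\in\mathcal{U}$ and $f_i(x,\cdot)$ is concave on $\mathcal{U}$ for every $x\in\mathcal{D}$. Let $D>0$ satisfy $D\ge\max_{u,v\in\mathcal{U}}\|u-v\|_2$ and let $G>0$ satisfy $\|\nabla_u f_i(x,u)\|_2\le G$ for all $i$, $x\in\mathcal{D}$, $u\in\mathcal{U}$. Let $\epsilon>0$ and let $\mathcal{O}_\epsilon$ be an $\epsilon$-approximate optimization oracle. Then the Dual-Subgradient algorithm (described in the context), run with accuracy $\epsilon$ and parameters $D,G$, either returns a $2\epsilon$-approximate solution to the robust feasibility problem $$\exists?\ x\in\mathcal{D}:\quad f_i(x,u_i)\le 0\quad\forall u_i\in\mathcal{U},\ i=1,\dots,m,$$ or correctly concludes that this problem is infeasible. The algorithm terminates after at most $\lceil G^2D^2/\epsilon^2\rceil=O(G^2D^2/\epsilon^2)$ calls to $\mathcal{O}_\epsilon$.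
   Context: A point $x\in\mathcal{D}$ is an $\alpha$-approximate solution of the robust feasibility problem if $f_i(x,u_i)\le\alpha$ for all $u_i\in\mathcal{U}$ and all $i=1,\dots,m$. An $\epsilon$-approximate optimization oracle $\mathcal{O}_\epsilon$ takes as input $(u_1,\dots,u_m)\in\mathcal{U}^m$ and either outputs some $x\in\mathcal{D}$ with $f_i(x,u_i)\le\epsilon$ for all $i$, or outputs "infeasible"; it may output "infeasible" only if there is no $x\in\mathcal{D}$ with $f_i(x,u_i)\le 0$ for all $i$. $\nabla_u f_i(x,u)$ denotes the gradient (or a fixed choice of supergradient) of the concave function $f_i(x,\cdot)$ at $u$. $\Pi_{\mathcal{U}}$ is the Euclidean projection onto $\mathcal{U}$. Dual-Subgradient algorithm: set $T=\lceil G^2D^2/\epsilon^2\rceil$ and $\eta=D/(G\sqrt{T})$. Choose $(u_1^1,\dots,u_m^1)\in\mathcal{U}^m$ arbitrarily. For $t=1,\dots,T$: if $t\ge 2$, set $u_i^t=\Pi_{\mathcal{U}}\big[u_i^{t-1}+\eta\nabla_u f_i(x^{t-1},u_i^{t-1})\big]$ for each $i=1,\dots,m$; then call $\mathcal{O}_\epsilon(u_1^t,\dots,u_m^t)$; if it outputs "infeasible", stop and return "infeasible"; otherwise let $x^t$ be its output. If all $T$ rounds are completed, return $\bar{x}=\frac1T\sum_{t=1}^T x^t$. *)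

theory Defs
  imports "HOL-Analysis.Analysis" "HOL-Library.Landau_Symbols"
begin

text \<open>The index type \<^typ>\<open>'m\<close> plays the role of \<open>{1,\<dots>,m}\<close>; an element of \<open>\<U>\<^sup>m\<close> is a function
  \<^typ>\<open>'m \<Rightarrow> real ^ 'd\<close> with all values in \<open>\<U>\<close>. A function on \<open>\<D> \<times> \<U>\<close> is a total function whose values
  outside \<open>\<D> \<times> \<U>\<close> are never constrained.\<close>

definition approx_robust_solution ::
  "(real ^ 'n) set \<Rightarrow> (real ^ 'd) set \<Rightarrow> ('m \<Rightarrow> real ^ 'n \<Rightarrow> real ^ 'd \<Rightarrow> real) \<Rightarrow> real \<Rightarrow> real ^ 'n \<Rightarrow> bool"
where
  "approx_robust_solution \<D> \<U> f \<alpha> x \<longleftrightarrow> x \<in> \<D> \<and> (\<forall>i. \<forall>u\<in>\<U>. f i x u \<le> \<alpha>)"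

definition robust_feasible ::
  "(real ^ 'n) set \<Rightarrow> (real ^ 'd) set \<Rightarrow> ('m \<Rightarrow> real ^ 'n \<Rightarrow> real ^ 'd \<Rightarrow> real) \<Rightarrow> bool"
where
  "robust_feasible \<D> \<U> f \<longleftrightarrow> (\<exists>x\<in>\<D>. \<forall>i. \<forall>u\<in>\<U>. f i x u \<le> 0)"

text \<open>Supergradients are relative to the set \<open>S\<close> on which \<open>h\<close> lives. If \<open>h\<close> is concave on \<open>S\<close> and
  differentiable at \<open>u \<in> S\<close>, then its gradient at \<open>u\<close> is a supergradient in this sense.\<close>

definition is_supergradient ::
  "(real ^ 'd) set \<Rightarrow> (real ^ 'd \<Rightarrow> real) \<Rightarrow> real ^ 'd \<Rightarrow> real ^ 'd \<Rightarrow> bool"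
where
  "is_supergradient S h u g \<longleftrightarrow> (\<forall>v\<in>S. h v \<le> h u + g \<bullet> (v - u))"

datatype 'x answer = Infeasible | Point 'x

definition approx_oracle ::
  "(real ^ 'n) set \<Rightarrow> (real ^ 'd) set \<Rightarrow> ('m \<Rightarrow> real ^ 'n \<Rightarrow> real ^ 'd \<Rightarrow> real) \<Rightarrow> real \<Rightarrow>
   (('m \<Rightarrow> real ^ 'd) \<Rightarrow> (real ^ 'n) answer) \<Rightarrow> bool"
where
  "approx_oracle \<D> \<U> f \<epsilon> \<O> \<longleftrightarrow>
     (\<forall>u. (\<forall>i. u i \<in> \<U>) \<longrightarrow>
       (case \<O> u of
          Point x \<Rightarrow> x \<in> \<D> \<and> (\<forall>i. f i x (u i) \<le> \<epsilon>)
        | Infeasible \<Rightarrow> \<not> (\<exists>x\<in>\<D>. \<forall>i. f i x (u i) \<le> 0)))"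

definition num_rounds :: "real \<Rightarrow> real \<Rightarrow> real \<Rightarrow> nat" where
  "num_rounds G D \<epsilon> = nat \<lceil>G\<^sup>2 * D\<^sup>2 / \<epsilon>\<^sup>2\<rceil>"

text \<open>The loop from round \<open>t\<close> on. Here \<open>u\<close> is the query of round \<open>t - 1\<close> (the initial tuple if
  \<open>t = 1\<close>) and \<open>xs\<close> lists the oracle's answers in rounds \<open>1, \<dots>, t - 1\<close>. The result consists of the
  returned value and the number of oracle calls made; it is \<^const>\<open>None\<close> iff the loop does not
  terminate.\<close>

partial_function (option) dual_subgradient_loop ::
  "nat \<Rightarrow> real \<Rightarrow> (real ^ 'd) set \<Rightarrow> ('m \<Rightarrow> real ^ 'n \<Rightarrow> real ^ 'd \<Rightarrow> real ^ 'd) \<Rightarrow>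
   (('m \<Rightarrow> real ^ 'd) \<Rightarrow> (real ^ 'n) answer) \<Rightarrow>
   nat \<Rightarrow> ('m \<Rightarrow> real ^ 'd) \<Rightarrow> (real ^ 'n) list \<Rightarrow> ((real ^ 'n) answer \<times> nat) option"
where
  "dual_subgradient_loop T \<eta> \<U> g \<O> t u xs =
     (if T < t then Some (Point ((1 / real T) *\<^sub>R sum_list xs), length xs)
      else
        let u' = (if 2 \<le> t then (\<lambda>i. closest_point \<U> (u i + \<eta> *\<^sub>R g i (last xs) (u i))) else u)
        in case \<O> u' of
             Infeasible \<Rightarrow> Some (Infeasible, Suc (length xs))
           | Point x \<Rightarrow> dual_subgradient_loop T \<eta> \<U> g \<O> (Suc t) u' (xs @ [x]))"

definition dual_subgradient ::
  "real \<Rightarrow> real \<Rightarrow> real \<Rightarrow> (real ^ 'd) set \<Rightarrow> ('m \<Rightarrow> real ^ 'n \<Rightarrow> real ^ 'd \<Rightarrow> real ^ 'd) \<Rightarrow>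
   (('m \<Rightarrow> real ^ 'd) \<Rightarrow> (real ^ 'n) answer) \<Rightarrow> ('m \<Rightarrow> real ^ 'd) \<Rightarrow>
   ((real ^ 'n) answer \<times> nat) option"
where
  "dual_subgradient G D \<epsilon> \<U> g \<O> u\<^sub>1 =
     (let T = num_rounds G D \<epsilon>; \<eta> = D / (G * sqrt (real T))
      in dual_subgradient_loop T \<eta> \<U> g \<O> 1 u\<^sub>1 [])"

end

theory Submission imports Defs
begin

text \<open>
  Each coordinate \<open>i\<close> of the adversary runs projected online gradient ascent on the concave payoffs
  \<open>f i x\<^sub>1\<close>, \<open>f i x\<^sub>2\<close>, \<dots>, where \<open>x\<^sub>t\<close> is the oracle's answer to the \<open>t\<close>-th query. One ascent step with
  a supergradient of norm at most \<open>G\<close> brings the query closer to a fixed \<open>v \<in> \<U>\<close> by an amount that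
  pays, up to an error \<open>\<eta>\<^sup>2 * G\<^sup>2\<close>, for what the query earned less than \<open>v\<close> in that round
  (\<open>supergradient_step_regret\<close>). The squared distances telescope over the rounds. Since every query is within
  \<open>D\<close> of \<open>v\<close> and the oracle keeps the payoff of every query at most \<open>\<epsilon>\<close>, any \<open>T\<close> completed rounds
  give
  \<open>2 * \<eta> * (\<Sum>t = 1..T. f i x\<^sub>t v) \<le> T * (2 * \<eta> * \<epsilon> + \<eta>\<^sup>2 * G\<^sup>2) + D\<^sup>2\<close>.
  For \<open>\<eta> = D / (G \<surd>T)\<close> the average payoff against \<open>v\<close> is thus at most \<open>\<epsilon> + G D / \<surd>T\<close>, and the
  choice of \<open>T\<close> makes this at most \<open>2 \<epsilon>\<close> (\<open>average_payoff_bound\<close>). Convexity of \<open>f i\<close> in the first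
  argument transfers the bound to the averaged point (\<open>convex_on_list_average\<close>).

  A verdict of infeasibility is correct because all queries stay in \<open>\<U>\<close>: a robustly feasible point
  would be feasible for the very query that the oracle rejected. The control
  flow is separated from this analysis: \<open>dual_subgradient_loop_invariant\<close> shows termination within \<open>T\<close>
  calls and hands any invariant of a single round to the point where the loop stops.
\<close>

definition ascent_step ::
  "real \<Rightarrow> (real ^ 'd) set \<Rightarrow> ('m \<Rightarrow> real ^ 'n \<Rightarrow> real ^ 'd \<Rightarrow> real ^ 'd) \<Rightarrow>
   real ^ 'n \<Rightarrow> ('m \<Rightarrow> real ^ 'd) \<Rightarrow> 'm \<Rightarrow> real ^ 'd"
where
  "ascent_step \<eta> \<U> g x u = (\<lambda>i. closest_point \<U> (u i + \<eta> *\<^sub>R g i x (u i)))"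

text \<open>The loop carries the query of the previous round and performs the ascent only at the start of
  the next one. The invariant is therefore stated for the query about to be posed; after the last
  round this is a query that is never submitted, but the telescoping sum ends with it.\<close>

lemma dual_subgradient_loop_invariant:
  assumes "I xs (if xs = [] then u else ascent_step \<eta> \<U> g (last xs) u)"
    and step: "\<And>ys w x. I ys w \<Longrightarrow> \<O> w = Point x \<Longrightarrow> I (ys @ [x]) (ascent_step \<eta> \<U> g x w)"
    and "length xs \<le> T"
  shows "\<exists>r k. dual_subgradient_loop T \<eta> \<U> g \<O> (Suc (length xs)) u xs = Some (r, k) \<and> k \<le> T \<and>
           (case r of
              Point z \<Rightarrow> \<exists>ys w. I ys w \<and> length ys = T \<and> z = (1 / real T) *\<^sub>R sum_list ys
            | Infeasible \<Rightarrow> \<exists>ys w. I ys w \<and> \<O> w = Infeasible)"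
  using assms(1,3)
proof (induction "T - length xs" arbitrary: u xs)
  case 0
  then have len: "length xs = T" by simp
  have "dual_subgradient_loop T \<eta> \<U> g \<O> (Suc (length xs)) u xs =
      Some (Point ((1 / real T) *\<^sub>R sum_list xs), length xs)"
    by (subst dual_subgradient_loop.simps) (simp add: len)
  with 0 len show ?case by auto
next
  case (Suc n)
  define w where "w = (if xs = [] then u else ascent_step \<eta> \<U> g (last xs) u)"
  have I: "I xs w" using Suc.prems by (simp add: w_def)
  have len: "length xs < T" using Suc.hyps by simp
  have "(if 2 \<le> Suc (length xs)
           then (\<lambda>i. closest_point \<U> (u i + \<eta> *\<^sub>R g i (last xs) (u i))) else u) = w"
    by (cases xs) (auto simp: w_def ascent_step_def)
  then have unfold: "dual_subgradient_loop T \<eta> \<U> g \<O> (Suc (length xs)) u xs =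
      (case \<O> w of
         Infeasible \<Rightarrow> Some (Infeasible, Suc (length xs))
       | Point x \<Rightarrow> dual_subgradient_loop T \<eta> \<U> g \<O> (Suc (Suc (length xs))) w (xs @ [x]))"
    using len by (subst dual_subgradient_loop.simps) (simp add: Let_def)
  show ?case
  proof (cases "\<O> w")
    case Infeasible
    then show ?thesis using unfold I len by auto
  next
    case (Point x)
    have "I (xs @ [x]) (ascent_step \<eta> \<U> g x w)" by (rule step[OF I Point])
    then show ?thesis
      using Suc.hyps(1)[of "xs @ [x]" w] Suc.hyps(2) len unfold Point by simp
  qed
qed

text \<open>Projecting onto \<open>U\<close> does not increase the distance to a point \<open>v\<close> of \<open>U\<close>; the rest is the
  expansion of \<open>norm (u + \<eta> *\<^sub>R g - v)\<close> squared, whose cross term is bounded by the supergradient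
  inequality.\<close>

lemma supergradient_step_regret:
  fixes U :: "(real ^ 'd) set"
  assumes "convex U" "closed U" "v \<in> U" "0 \<le> \<eta>" "norm g \<le> G" "is_supergradient U h u g"
  shows "2 * \<eta> * h v \<le> 2 * \<eta> * h u + \<eta>\<^sup>2 * G\<^sup>2
           + (norm (u - v))\<^sup>2 - (norm (closest_point U (u + \<eta> *\<^sub>R g) - v))\<^sup>2"
proof -
  have "norm (closest_point U (u + \<eta> *\<^sub>R g) - v) \<le> norm (u + \<eta> *\<^sub>R g - v)"
    using closest_point_lipschitz[of U "u + \<eta> *\<^sub>R g" v] assms
    by (auto simp: closest_point_self dist_norm)
  then have "(norm (closest_point U (u + \<eta> *\<^sub>R g) - v))\<^sup>2 \<le> (norm (u + \<eta> *\<^sub>R g - v))\<^sup>2"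
    by (simp add: power_mono)
  also have "\<dots> = (norm (u - v))\<^sup>2 - 2 * \<eta> * (g \<bullet> (v - u)) + \<eta>\<^sup>2 * (norm g)\<^sup>2"
    by (simp only: power2_norm_eq_inner)
      (simp add: inner_simps inner_commute power2_eq_square algebra_simps)
  also have "\<dots> \<le> (norm (u - v))\<^sup>2 - 2 * \<eta> * (g \<bullet> (v - u)) + \<eta>\<^sup>2 * G\<^sup>2"
    using assms(5) by (simp add: mult_left_mono power_mono)
  finally have dist: "(norm (closest_point U (u + \<eta> *\<^sub>R g) - v))\<^sup>2
      \<le> (norm (u - v))\<^sup>2 - 2 * \<eta> * (g \<bullet> (v - u)) + \<eta>\<^sup>2 * G\<^sup>2" .
  have "2 * \<eta> * h v \<le> 2 * \<eta> * (h u + g \<bullet> (v - u))"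
    using assms(3,4,6) by (intro mult_left_mono) (auto simp: is_supergradient_def)
  with dist show ?thesis by (simp add: algebra_simps)
qed

text \<open>The step size \<open>\<eta>\<close> balances the two error terms \<open>\<eta> * G\<^sup>2 / 2\<close> and \<open>D\<^sup>2 / (2 * \<eta> * N)\<close> of the
  average regret, which makes each equal to \<open>G * D / (2 * sqrt N)\<close>.\<close>

lemma average_payoff_bound:
  fixes D G \<epsilon> N S :: real
  assumes pos: "D > 0" "G > 0" "\<epsilon> > 0" "N > 0"
    and N: "G\<^sup>2 * D\<^sup>2 / \<epsilon>\<^sup>2 \<le> N" and eta: "\<eta> = D / (G * sqrt N)"
    and S: "2 * \<eta> * S \<le> N * (2 * \<eta> * \<epsilon> + \<eta>\<^sup>2 * G\<^sup>2) + D\<^sup>2"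
  shows "S \<le> N * (2 * \<epsilon>)"
proof -
  have eta_pos: "\<eta> > 0" using pos by (simp add: eta)
  have sq: "sqrt N * sqrt N = N" using pos by simp
  have "(G * D)\<^sup>2 \<le> (\<epsilon> * sqrt N)\<^sup>2"
    using N pos by (simp add: field_simps power_mult_distrib)
  then have GD: "G * D \<le> \<epsilon> * sqrt N"
    by (rule power2_le_imp_le) (use pos in simp)
  have etaG: "\<eta> * (G * sqrt N) = D" using pos by (simp add: eta)
  have "N * (\<eta>\<^sup>2 * G\<^sup>2) = (\<eta> * (G * sqrt N))\<^sup>2"
    using pos by (simp add: power_mult_distrib)
  then have "N * (\<eta>\<^sup>2 * G\<^sup>2) = D\<^sup>2" by (simp only: etaG)
  then have "2 * \<eta> * S \<le> 2 * \<eta> * (N * \<epsilon>) + 2 * D\<^sup>2"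
    using S by (simp add: algebra_simps)
  also have "D\<^sup>2 = \<eta> * (sqrt N * (G * D))"
    using etaG by (simp add: power2_eq_square mult_ac)
  also have "2 * \<eta> * (N * \<epsilon>) + 2 * (\<eta> * (sqrt N * (G * D)))
      \<le> 2 * \<eta> * (N * \<epsilon>) + 2 * (\<eta> * (sqrt N * (\<epsilon> * sqrt N)))"
    using GD eta_pos pos by (intro add_left_mono mult_left_mono) auto
  also have "sqrt N * (\<epsilon> * sqrt N) = N * \<epsilon>"
    using sq by (simp add: mult_ac)
  finally have "2 * \<eta> * S \<le> 2 * \<eta> * (N * (2 * \<epsilon>))" by (simp add: algebra_simps)
  then show ?thesis using eta_pos by simp
qed

text \<open>Jensen's inequality for the uniform average of a list.\<close>

lemma convex_on_list_average:
  fixes h :: "'a::real_vector \<Rightarrow> real"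
  assumes h: "convex_on C h" and xs: "set xs \<subseteq> C" "xs \<noteq> []"
  shows "(1 / real (length xs)) *\<^sub>R sum_list xs \<in> C"
    and "real (length xs) * h ((1 / real (length xs)) *\<^sub>R sum_list xs) \<le> (\<Sum>x\<leftarrow>xs. h x)"
proof -
  let ?n = "length xs" and ?a = "\<lambda>_::nat. 1 / real (length xs)"
  have n: "?n > 0" and mem: "\<And>i. i \<in> {0..<?n} \<Longrightarrow> xs ! i \<in> C"
    using xs by auto
  have one: "(\<Sum>i = 0..<?n. ?a i) = 1" using n by simp
  have avg: "(1 / real ?n) *\<^sub>R sum_list xs = (\<Sum>i = 0..<?n. ?a i *\<^sub>R xs ! i)"
    by (simp add: sum_list_sum_nth scaleR_sum_right)
  show "(1 / real ?n) *\<^sub>R sum_list xs \<in> C"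
    unfolding avg using convex_on_imp_convex[OF h] one mem by (intro convex_sum) auto
  have "h (\<Sum>i = 0..<?n. ?a i *\<^sub>R xs ! i) \<le> (\<Sum>i = 0..<?n. ?a i * h (xs ! i))"
    using h one mem n by (intro convex_on_sum) auto
  also have "\<dots> = (\<Sum>x\<leftarrow>xs. h x) / real ?n"
    by (simp add: sum_list_sum_nth sum_divide_distrib)
  finally show "real ?n * h ((1 / real ?n) *\<^sub>R sum_list xs) \<le> (\<Sum>x\<leftarrow>xs. h x)"
    using n by (simp add: avg field_simps)
qed

text \<open>Rounding up costs less than \<open>1\<close>, so it at most doubles a quantity that is at least \<open>1\<close>.\<close>

lemma ceiling_bigo_filtercomap_at_top:
  fixes h :: "'a \<Rightarrow> real"
  shows "(\<lambda>p. real_of_int \<lceil>h p\<rceil>) \<in> O[filtercomap h at_top](h)"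
proof (rule bigoI[where c = 2])
  have "norm (real_of_int \<lceil>h p\<rceil>) \<le> 2 * norm (h p)" if "1 \<le> h p" for p
    using that ceiling_correct[of "h p"] by simp
  moreover have "\<forall>\<^sub>F p in filtercomap h at_top. 1 \<le> h p"
    by (intro eventually_filtercomapI eventually_ge_at_top)
  ultimately show "\<forall>\<^sub>F p in filtercomap h at_top. norm (real_of_int \<lceil>h p\<rceil>) \<le> 2 * norm (h p)"
    by (rule eventually_mono[rotated])
qed

theorem theorem3:
  fixes \<D> :: "(real ^ 'n) set" and \<U> :: "(real ^ 'd) set"
    and f :: "'m::finite \<Rightarrow> real ^ 'n \<Rightarrow> real ^ 'd \<Rightarrow> real"
    and g :: "'m \<Rightarrow> real ^ 'n \<Rightarrow> real ^ 'd \<Rightarrow> real ^ 'd"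
    and D G \<epsilon> :: real
    and \<O> :: "('m \<Rightarrow> real ^ 'd) \<Rightarrow> (real ^ 'n) answer"
    and u\<^sub>1 :: "'m \<Rightarrow> real ^ 'd"
  assumes "convex \<D>"
    and "\<U> \<noteq> {}" and "closed \<U>" and "bounded \<U>" and "convex \<U>"
    and "\<And>i u. u \<in> \<U> \<Longrightarrow> convex_on \<D> (\<lambda>x. f i x u)"
    and "\<And>i x. x \<in> \<D> \<Longrightarrow> concave_on \<U> (f i x)"
    and "\<And>i x u. x \<in> \<D> \<Longrightarrow> u \<in> \<U> \<Longrightarrow> is_supergradient \<U> (f i x) u (g i x u)"
    and "D > 0" and "diameter \<U> \<le> D"
    and "G > 0" and "\<And>i x u. x \<in> \<D> \<Longrightarrow> u \<in> \<U> \<Longrightarrow> norm (g i x u) \<le> G"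
    and "\<epsilon> > 0" and "approx_oracle \<D> \<U> f \<epsilon> \<O>"
    and "\<And>i. u\<^sub>1 i \<in> \<U>"
  shows "(\<exists>r k. dual_subgradient G D \<epsilon> \<U> g \<O> u\<^sub>1 = Some (r, k) \<and>
            (case r of
               Point x \<Rightarrow> approx_robust_solution \<D> \<U> f (2 * \<epsilon>) x
             | Infeasible \<Rightarrow> \<not> robust_feasible \<D> \<U> f) \<and>
            int k \<le> \<lceil>G\<^sup>2 * D\<^sup>2 / \<epsilon>\<^sup>2\<rceil>)
         \<and> (\<lambda>(G, D, \<epsilon>). real_of_int \<lceil>G\<^sup>2 * D\<^sup>2 / \<epsilon>\<^sup>2\<rceil>)
             \<in> O[filtercomap (\<lambda>(G, D, \<epsilon>). G\<^sup>2 * D\<^sup>2 / \<epsilon>\<^sup>2 :: real) at_top](\<lambda>(G, D, \<epsilon>). G\<^sup>2 * D\<^sup>2 / \<epsilon>\<^sup>2)"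
proof
  define T where "T = num_rounds G D \<epsilon>"
  define \<eta> where "\<eta> = D / (G * sqrt (real T))"
  have pos: "G\<^sup>2 * D\<^sup>2 / \<epsilon>\<^sup>2 > 0" using \<open>D > 0\<close> \<open>G > 0\<close> \<open>\<epsilon> > 0\<close> by simp
  then have T_int: "int T = \<lceil>G\<^sup>2 * D\<^sup>2 / \<epsilon>\<^sup>2\<rceil>" by (simp add: T_def num_rounds_def)
  then have T_ge: "G\<^sup>2 * D\<^sup>2 / \<epsilon>\<^sup>2 \<le> real T"
    by (metis le_of_int_ceiling of_int_of_nat_eq)
  with pos have T_pos: "real T > 0" by linarith
  have eta_nonneg: "\<eta> \<ge> 0" using \<open>D > 0\<close> \<open>G > 0\<close> by (simp add: \<eta>_def)

  \<comment> \<open>The telescoped regret against every \<open>v\<close>. The subtracted distance is what the next round uses up;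
      it is dropped only at the end.\<close>
  define I where "I xs w \<longleftrightarrow> set xs \<subseteq> \<D> \<and> (\<forall>i. w i \<in> \<U>) \<and>
      (\<forall>i. \<forall>v\<in>\<U>. 2 * \<eta> * (\<Sum>x\<leftarrow>xs. f i x v)
         \<le> real (length xs) * (2 * \<eta> * \<epsilon> + \<eta>\<^sup>2 * G\<^sup>2) + D\<^sup>2 - (norm (w i - v))\<^sup>2)"
    for xs and w :: "'m \<Rightarrow> real ^ 'd"

  have dist: "(norm (w - v))\<^sup>2 \<le> D\<^sup>2" if "w \<in> \<U>" "v \<in> \<U>" for w v
    using diameter_bounded_bound[OF \<open>bounded \<U>\<close> that] \<open>diameter \<U> \<le> D\<close>
    by (intro power_mono) (auto simp: dist_norm)
  have init: "I [] u\<^sub>1"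
    using assms(15) dist by (simp add: I_def)
  have step: "I (ys @ [x]) (ascent_step \<eta> \<U> g x w)" if I: "I ys w" and ans: "\<O> w = Point x" for ys w x
  proof -
    have w: "w i \<in> \<U>" for i using I by (simp add: I_def)
    have x: "x \<in> \<D>" and fx: "f i x (w i) \<le> \<epsilon>" for i
      using \<open>approx_oracle \<D> \<U> f \<epsilon> \<O>\<close> w ans by (auto simp: approx_oracle_def split: answer.splits)
    have "ascent_step \<eta> \<U> g x w i \<in> \<U>" for i
      using \<open>closed \<U>\<close> \<open>\<U> \<noteq> {}\<close> by (simp add: ascent_step_def closest_point_in_set)
    moreover have "2 * \<eta> * (\<Sum>y\<leftarrow>ys @ [x]. f i y v)
        \<le> real (length (ys @ [x])) * (2 * \<eta> * \<epsilon> + \<eta>\<^sup>2 * G\<^sup>2) + D\<^sup>2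
          - (norm (ascent_step \<eta> \<U> g x w i - v))\<^sup>2" if v: "v \<in> \<U>" for i v
    proof -
      have "2 * \<eta> * (\<Sum>y\<leftarrow>ys. f i y v)
          \<le> real (length ys) * (2 * \<eta> * \<epsilon> + \<eta>\<^sup>2 * G\<^sup>2) + D\<^sup>2 - (norm (w i - v))\<^sup>2"
        using I v by (simp add: I_def)
      moreover have "2 * \<eta> * f i x v \<le> 2 * \<eta> * f i x (w i) + \<eta>\<^sup>2 * G\<^sup>2 + (norm (w i - v))\<^sup>2
          - (norm (ascent_step \<eta> \<U> g x w i - v))\<^sup>2"
        unfolding ascent_step_def
        using \<open>convex \<U>\<close> \<open>closed \<U>\<close> v eta_nonneg assms(12)[OF x w] assms(8)[OF x w]
        by (rule supergradient_step_regret)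
      moreover have "2 * \<eta> * f i x (w i) \<le> 2 * \<eta> * \<epsilon>"
        using fx eta_nonneg by (intro mult_left_mono) auto
      ultimately show ?thesis by (simp add: algebra_simps)
    qed
    ultimately show ?thesis using I x by (simp add: I_def)
  qed

  obtain r k where run: "dual_subgradient_loop T \<eta> \<U> g \<O> 1 u\<^sub>1 [] = Some (r, k)" and k: "k \<le> T"
    and r: "case r of
              Point z \<Rightarrow> \<exists>ys w. I ys w \<and> length ys = T \<and> z = (1 / real T) *\<^sub>R sum_list ys
            | Infeasible \<Rightarrow> \<exists>ys w. I ys w \<and> \<O> w = Infeasible"
    using dual_subgradient_loop_invariant[of I "[]" u\<^sub>1 \<eta> \<U> g \<O> T] init step by auto

  have "case r of
      Point x \<Rightarrow> approx_robust_solution \<D> \<U> f (2 * \<epsilon>) x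
    | Infeasible \<Rightarrow> \<not> robust_feasible \<D> \<U> f"
  proof (cases r)
    case Infeasible
    then obtain ys w where I: "I ys w" and ans: "\<O> w = Infeasible" using r by auto
    \<comment> \<open>A robustly feasible point would in particular answer the query \<open>w\<close>.\<close>
    have w: "\<forall>i. w i \<in> \<U>" using I by (simp add: I_def)
    with ans have "\<not> (\<exists>x\<in>\<D>. \<forall>i. f i x (w i) \<le> 0)"
      using \<open>approx_oracle \<D> \<U> f \<epsilon> \<O>\<close> by (auto simp: approx_oracle_def split: answer.splits)
    with w have "\<not> robust_feasible \<D> \<U> f" unfolding robust_feasible_def by blast
    then show ?thesis using Infeasible by simp
  next
    case (Point z)
    then obtain ys w where I: "I ys w" and len: "length ys = T"
      and z: "z = (1 / real T) *\<^sub>R sum_list ys" using r by auto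
    have ys: "set ys \<subseteq> \<D>" "ys \<noteq> []" using I len T_pos by (auto simp: I_def)
    note average = convex_on_list_average[OF assms(6) ys, unfolded len, folded z]
    have "f i z v \<le> 2 * \<epsilon>" if v: "v \<in> \<U>" for i v
    proof -
      have "2 * \<eta> * (\<Sum>x\<leftarrow>ys. f i x v)
          \<le> real T * (2 * \<eta> * \<epsilon> + \<eta>\<^sup>2 * G\<^sup>2) + D\<^sup>2 - (norm (w i - v))\<^sup>2"
        using I len v by (simp add: I_def)
      also have "\<dots> \<le> real T * (2 * \<eta> * \<epsilon> + \<eta>\<^sup>2 * G\<^sup>2) + D\<^sup>2" by simp
      finally have "(\<Sum>x\<leftarrow>ys. f i x v) \<le> real T * (2 * \<epsilon>)"
        by (rule average_payoff_bound[OF \<open>D > 0\<close> \<open>G > 0\<close> \<open>\<epsilon> > 0\<close> T_pos T_ge \<eta>_def])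
      with average(2)[OF v, of i] have "real T * f i z v \<le> real T * (2 * \<epsilon>)" by linarith
      then show ?thesis using T_pos by simp
    qed
    moreover have "z \<in> \<D>" using \<open>\<U> \<noteq> {}\<close> average(1) by blast
    ultimately show ?thesis using Point by (simp add: approx_robust_solution_def)
  qed
  moreover have "dual_subgradient G D \<epsilon> \<U> g \<O> u\<^sub>1 = Some (r, k)"
    using run by (simp add: dual_subgradient_def T_def \<eta>_def)
  moreover have "int k \<le> \<lceil>G\<^sup>2 * D\<^sup>2 / \<epsilon>\<^sup>2\<rceil>" using k T_int by simp
  ultimately show "\<exists>r k. dual_subgradient G D \<epsilon> \<U> g \<O> u\<^sub>1 = Some (r, k) \<and>
            (case r of
               Point x \<Rightarrow> approx_robust_solution \<D> \<U> f (2 * \<epsilon>) x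
             | Infeasible \<Rightarrow> \<not> robust_feasible \<D> \<U> f) \<and>
            int k \<le> \<lceil>G\<^sup>2 * D\<^sup>2 / \<epsilon>\<^sup>2\<rceil>" by blast
next
  show "(\<lambda>(G, D, \<epsilon>). real_of_int \<lceil>G\<^sup>2 * D\<^sup>2 / \<epsilon>\<^sup>2\<rceil>)
      \<in> O[filtercomap (\<lambda>(G, D, \<epsilon>). G\<^sup>2 * D\<^sup>2 / \<epsilon>\<^sup>2 :: real) at_top](\<lambda>(G, D, \<epsilon>). G\<^sup>2 * D\<^sup>2 / \<epsilon>\<^sup>2)"
    using ceiling_bigo_filtercomap_at_top[of "\<lambda>(G, D, \<epsilon>). G\<^sup>2 * D\<^sup>2 / \<epsilon>\<^sup>2 :: real"]
    by (simp add: case_prod_unfold)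
qed

end
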